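(* Let $d \geq 1$, let $S$ be a finite set with $0 \in S$, let $X \subset S^{\mathbb{Z}^d}$ be a subshift, and let $c : X \to X$ be a cellular automaton. Then $c$ is $0$-nilpotent if and only if $c$ is weakly $0$-nilpotent.
   Context: $S^{\mathbb{Z}^d}$ carries the product topology of the discrete topology on the finite set $S$. For $v \in \mathbb{Z}^d$ the shift $\sigma^v$ is defined by $\sigma^v(x)_u = x_{u+v}$. A subshift is a topologically closed subset $X \subset S^{\mathbb{Z}^d}$ that is invariant under $\sigma^v$ for all $v \in \mathbb{Z}^d$. A cellular automaton on $X$ is a continuous map $c : X \to X$ that commutes with $\sigma^v$ for all $v \in \mathbb{Z}^d$. $c^n$ denotes the $n$-fold iterate of $c$. $c$ is $0$-nilpotent if there exists $m \in \mathbb{N}$ such that for all $n \geq m$, all $x \in X$ and all $v \in \mathbb{Z}^d$, $c^n(x)_v = 0$. $c$ is weakly $0$-nilpotent if for all $x \in X$ there exists $m \in \mathbb{N}$ such that for all $n \geq m$ and all $v \in \mathbb{Z}^d$, $c^n(x)_v = 0$. *)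

theory Defs
  imports "HOL-Analysis.Analysis"
begin

text \<open>
  The lattice is the type \<open>int ^ 'd\<close>, with \<open>'d\<close> an arbitrary finite index type (so its
  dimension \<open>CARD('d)\<close> is an arbitrary positive number). The alphabet is an explicit set \<open>S\<close>.
\<close>

type_synonym ('s, 'd) config = "int ^ 'd \<Rightarrow> 's"

definition full_shift :: "'s set \<Rightarrow> ('s, 'd::finite) config topology" where
  "full_shift S = product_topology (\<lambda>_. discrete_topology S) UNIV"

definition shift :: "int ^ 'd \<Rightarrow> ('s, 'd::finite) config \<Rightarrow> ('s, 'd) config" where
  "shift v x = (\<lambda>u. x (u + v))"

definition subshift :: "'s set \<Rightarrow> ('s, 'd::finite) config set \<Rightarrow> bool" where
  "subshift S X \<longleftrightarrow> closedin (full_shift S) X \<and> (\<forall>v. \<forall>x\<in>X. shift v x \<in> X)"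

text \<open>
  A cellular automaton on \<open>X\<close> is represented by a total function of which only the values on \<open>X\<close>
  matter; \<open>continuous_map\<close> includes that it maps \<open>X\<close> into \<open>X\<close>.
\<close>

definition cellular_automaton ::
  "'s set \<Rightarrow> ('s, 'd::finite) config set \<Rightarrow> (('s, 'd) config \<Rightarrow> ('s, 'd) config) \<Rightarrow> bool" where
  "cellular_automaton S X c \<longleftrightarrow>
     continuous_map (subtopology (full_shift S) X) (subtopology (full_shift S) X) c \<and>
     (\<forall>v. \<forall>x\<in>X. c (shift v x) = shift v (c x))"

text \<open>The distinguished symbol, usually written 0, is the parameter \<open>z\<close>.\<close>

definition nilpotent ::
  "'s \<Rightarrow> ('s, 'd::finite) config set \<Rightarrow> (('s, 'd) config \<Rightarrow> ('s, 'd) config) \<Rightarrow> bool" where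
  "nilpotent z X c \<longleftrightarrow> (\<exists>m. \<forall>n\<ge>m. \<forall>x\<in>X. \<forall>v. (c ^^ n) x v = z)"

definition weakly_nilpotent ::
  "'s \<Rightarrow> ('s, 'd::finite) config set \<Rightarrow> (('s, 'd) config \<Rightarrow> ('s, 'd) config) \<Rightarrow> bool" where
  "weakly_nilpotent z X c \<longleftrightarrow> (\<forall>x\<in>X. \<exists>m. \<forall>n\<ge>m. \<forall>v. (c ^^ n) x v = z)"

end

theory Submission
  imports Defs
begin

text \<open>
  Only one implication has content: weak nilpotency must be made uniform. Call a cell alive if its
  symbol is not \<open>z\<close>. If \<open>c\<close> is weakly nilpotent and \<open>X\<close> is nonempty, then some orbit ends in the
  constant configuration \<open>z\<close>, which is therefore a fixed point of \<open>c\<close>. Since information in a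
  cellular automaton travels at bounded speed, an alive cell cannot arise from nothing: there is a
  finite set \<open>N\<close> such that \<open>c x u \<noteq> z\<close> forces \<open>x (u + v) \<noteq> z\<close> for some \<open>v \<in> N\<close>
  (\<open>finite_ancestor_window\<close>). A cell that is still alive at time \<open>n\<close> is the end of a path of alive
  cells that starts at time \<open>0\<close> and moves by an element of \<open>-N\<close> in each step (\<open>survivor_has_past\<close>).

  Suppose that \<open>c\<close> is not nilpotent, so that there are such paths of unbounded length. The idea is to
  centre each configuration at the \<^emph>\<open>start\<close> of its path rather than at the cell that survives. The
  path then stays, at each time \<open>t\<close>, in a finite set that does not depend on its length, and being
  alive somewhere in a finite set is a closed condition. By compactness some configuration in \<open>X\<close>
  satisfies these conditions for all \<open>t\<close> at once (\<open>immortal_configuration\<close>). It never dies, which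
  contradicts weak nilpotency.
\<close>

lemma compact_space_subshift:
  assumes "finite S" "subshift S X"
  shows "compact_space (subtopology (full_shift S) X)"
proof -
  have "compact_space (full_shift S :: ('a, 'b) config topology)"
    unfolding full_shift_def
    by (simp add: compact_space_product_topology compact_space_discrete_topology assms(1))
  moreover have "closedin (full_shift S) X"
    using assms(2) unfolding subshift_def by (rule conjunct1)
  ultimately show ?thesis
    by (intro compact_space_subtopology closedin_compact_space)
qed

lemma topspace_subshift:
  assumes "subshift S X"
  shows "topspace (subtopology (full_shift S) X) = X"
  using assms unfolding subshift_def
  by (intro topspace_subtopology_subset closedin_subset) (rule conjunct1)

lemma shift_in_subshift: "subshift S X \<Longrightarrow> x \<in> X \<Longrightarrow> shift v x \<in> X"
  unfolding subshift_def by blast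

lemma continuous_map_iterate:
  assumes "cellular_automaton S X c"
  shows "continuous_map (subtopology (full_shift S) X) (subtopology (full_shift S) X) (c ^^ n)"
proof (induction n)
  case 0
  then show ?case by (simp add: id_def)
next
  case (Suc n)
  moreover have "continuous_map (subtopology (full_shift S) X) (subtopology (full_shift S) X) c"
    using assms unfolding cellular_automaton_def by (rule conjunct1)
  ultimately show ?case
    unfolding funpow.simps by (rule continuous_map_compose)
qed

lemma iterate_in_subshift:
  assumes "subshift S X" "cellular_automaton S X c" "x \<in> X"
  shows "(c ^^ n) x \<in> X"
  using continuous_map_funspace[OF continuous_map_iterate[OF assms(2), of n]] assms(3)
  unfolding topspace_subshift[OF assms(1)] by (rule funcset_mem)

lemma iterate_shift:
  assumes "subshift S X" "cellular_automaton S X c" "x \<in> X"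
  shows "(c ^^ n) (shift v x) = shift v ((c ^^ n) x)"
proof (induction n)
  case (Suc n)
  then show ?case
    using iterate_in_subshift[OF assms, of n] assms(2) by (simp add: cellular_automaton_def)
qed simp

lemma closedin_alive:
  assumes "subshift S X" "cellular_automaton S X c"
  shows "closedin (subtopology (full_shift S) X) {x \<in> X. (c ^^ n) x v \<noteq> z}"
proof -
  let ?T = "subtopology (full_shift S) X"
  have proj: "continuous_map (full_shift S) (discrete_topology S) (\<lambda>x. x v)"
    unfolding full_shift_def by (rule continuous_map_product_projection) simp
  have "continuous_map ?T (full_shift S) (c ^^ n)"
    using continuous_map_iterate[OF assms(2)] by (rule continuous_map_into_fulltopology)
  then have cont: "continuous_map ?T (discrete_topology S) (\<lambda>x. (c ^^ n) x v)"
    using continuous_map_compose[OF _ proj] by (auto simp: o_def)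
  then have "closedin ?T {x \<in> topspace ?T. (c ^^ n) x v \<in> S - {z}}"
    by (rule closedin_continuous_map_preimage) simp
  moreover have "(c ^^ n) x v \<in> S" if "x \<in> X" for x
    using continuous_map_funspace[OF cont] that
    unfolding topspace_subshift[OF assms(1)] topspace_discrete_topology by (rule funcset_mem)
  ultimately show ?thesis
    unfolding topspace_subshift[OF assms(1)] by (simp cong: conj_cong)
qed

lemma openin_cell_alive:
  assumes "subshift S X"
  shows "openin (subtopology (full_shift S) X) {x \<in> X. x v \<noteq> z}"
proof -
  let ?T = "subtopology (full_shift S) X"
  have cont: "continuous_map ?T (discrete_topology S) (\<lambda>x. x v)"
    unfolding full_shift_def
    by (intro continuous_map_from_subtopology continuous_map_product_projection) simp
  then have "openin ?T {x \<in> topspace ?T. x v \<in> S - {z}}"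
    by (rule openin_continuous_map_preimage) simp
  moreover have "x v \<in> S" if "x \<in> X" for x
    using continuous_map_funspace[OF cont] that
    unfolding topspace_subshift[OF assms] topspace_discrete_topology by (rule funcset_mem)
  ultimately show ?thesis
    unfolding topspace_subshift[OF assms] by (simp cong: conj_cong)
qed

text \<open>
  The configurations whose image is alive at the origin form a compact set. It misses the constant
  configuration \<open>z\<close>, so the open sets of configurations alive at a given cell cover it, and the
  cells of a finite subcover form \<open>N\<close>; commutation with shifts carries this to all cells.
\<close>

lemma finite_ancestor_window:
  fixes X :: "('s, 'd::finite) config set"
  assumes fin: "finite S" and sub: "subshift S X" and ca: "cellular_automaton S X c"
    and fixed: "c (\<lambda>_. z) = (\<lambda>_. z)"
  obtains N where "finite N"
    and "\<And>x u. x \<in> X \<Longrightarrow> c x u \<noteq> z \<Longrightarrow> \<exists>v\<in>N. x (u + v) \<noteq> z"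
proof -
  let ?T = "subtopology (full_shift S) X"
  let ?A = "{x \<in> X. c x 0 \<noteq> z}" and ?U = "\<lambda>v. {x \<in> X. x v \<noteq> z}"
  have "closedin ?T ?A"
    using closedin_alive[OF sub ca, of 1 0 z] by simp
  then have "compactin ?T ?A"
    using closedin_compact_space compact_space_subshift[OF fin sub] by blast
  moreover have "\<forall>B \<in> range ?U. openin ?T B"
    using openin_cell_alive[OF sub] by blast
  moreover have "?A \<subseteq> \<Union>(range ?U)"
  proof
    fix x assume "x \<in> ?A"
    then have "x \<noteq> (\<lambda>_. z)" using fixed by auto
    with \<open>x \<in> ?A\<close> show "x \<in> \<Union>(range ?U)" by auto
  qed
  ultimately have "\<exists>F. finite F \<and> F \<subseteq> range ?U \<and> ?A \<subseteq> \<Union>F"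
    by (intro compactinD[of ?T]) auto
  then obtain F where F: "finite F" "F \<subseteq> range ?U" "?A \<subseteq> \<Union>F"
    by (elim exE conjE)
  obtain N where "finite N" "F = ?U ` N"
    using finite_subset_image[OF F(1,2)] by (elim exE conjE)
  with F(3) have N: "finite N" "?A \<subseteq> \<Union>(?U ` N)"
    by simp_all
  have "\<exists>v\<in>N. x (u + v) \<noteq> z" if "x \<in> X" "c x u \<noteq> z" for x u
  proof -
    have "c (shift u x) 0 \<noteq> z"
      using that ca by (simp add: cellular_automaton_def shift_def)
    then have "shift u x \<in> ?A"
      using shift_in_subshift[OF sub] that(1) by blast
    with N(2) have "\<exists>v\<in>N. shift u x v \<noteq> z" by blast
    then show ?thesis by (simp add: shift_def add.commute)
  qed
  with N(1) show thesis by (rule that)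
qed

text \<open>
  The displacements possible for a path of alive cells after \<open>t\<close> steps. Its steps are the negatives
  of the elements of \<open>N\<close>, because \<open>N\<close> points from a cell to its ancestors.
\<close>

primrec reach :: "(int ^ 'd) set \<Rightarrow> nat \<Rightarrow> (int ^ 'd::finite) set" where
  "reach N 0 = {0}"
| "reach N (Suc t) = (\<Union>v\<in>N. (\<lambda>w. w - v) ` reach N t)"

lemma finite_reach: "finite N \<Longrightarrow> finite (reach N t)"
  by (induction t) auto

text \<open>
  The cell \<open>w\<close> is the time-\<open>0\<close> end of the chain of ancestors of the alive cell \<open>u\<close>. The first conjunct
  locates \<open>u\<close> relative to \<open>w\<close>; it is what lets the chain be extended by one step in time.
\<close>

lemma survivor_has_past:
  fixes X :: "('s, 'd::finite) config set"
  assumes sub: "subshift S X" and ca: "cellular_automaton S X c" and "x \<in> X"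
    and N: "\<And>x u. x \<in> X \<Longrightarrow> c x u \<noteq> z \<Longrightarrow> \<exists>v\<in>N. x (u + v) \<noteq> z"
    and "(c ^^ n) x u \<noteq> z"
  shows "\<exists>w. u - w \<in> reach N n \<and> (\<forall>t\<le>n. \<exists>v\<in>reach N t. (c ^^ t) x (w + v) \<noteq> z)"
  using assms(5)
proof (induction n arbitrary: u)
  case 0
  then show ?case by (intro exI[of _ u]) simp
next
  case (Suc n)
  obtain v where v: "v \<in> N" "(c ^^ n) x (u + v) \<noteq> z"
    using N[OF iterate_in_subshift[OF sub ca \<open>x \<in> X\<close>, of n]] Suc.prems by auto
  obtain w where w: "u + v - w \<in> reach N n"
    and past: "\<forall>t\<le>n. \<exists>v\<in>reach N t. (c ^^ t) x (w + v) \<noteq> z"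
    using Suc.IH[OF v(2)] by blast
  have "u - w = (u + v - w) - v" by simp
  with v(1) w have "u - w \<in> reach N (Suc n)"
    unfolding reach.simps by blast
  moreover have "(c ^^ Suc n) x (w + (u - w)) \<noteq> z"
    using Suc.prems by simp
  ultimately show ?case
    using past by (metis le_Suc_eq)
qed

text \<open>
  The sets of configurations with a path of length at least \<open>n\<close> from the origin decrease with \<open>n\<close>,
  are closed, and are nonempty if there are survivors at arbitrarily late times; a common element
  never dies.
\<close>

lemma immortal_configuration:
  fixes X :: "('s, 'd::finite) config set"
  assumes fin: "finite S" and sub: "subshift S X" and ca: "cellular_automaton S X c"
    and fixed: "c (\<lambda>_. z) = (\<lambda>_. z)"
    and "\<not> nilpotent z X c"
  shows "\<exists>x\<in>X. \<forall>t. \<exists>v. (c ^^ t) x v \<noteq> z"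
proof -
  let ?T = "subtopology (full_shift S) X"
  obtain N where N: "finite N"
    "\<And>x u. x \<in> X \<Longrightarrow> c x u \<noteq> z \<Longrightarrow> \<exists>v\<in>N. x (u + v) \<noteq> z"
    using finite_ancestor_window[OF fin sub ca fixed] by blast
  define K where "K n = (\<Inter>t\<in>{..n}. \<Union>v\<in>reach N t. {x \<in> X. (c ^^ t) x v \<noteq> z})" for n :: nat
  have "closedin ?T (K n)" for n
    unfolding K_def
    by (rule closedin_Inter)
      (auto intro!: closedin_Union closedin_alive[OF sub ca] finite_reach N(1))
  moreover have "K n \<noteq> {}" for n
  proof -
    obtain m x u where "n \<le> m" and x: "x \<in> X" and "(c ^^ m) x u \<noteq> z"
      using assms(5) unfolding nilpotent_def by blast
    then obtain w where w: "\<forall>t\<le>m. \<exists>v\<in>reach N t. (c ^^ t) x (w + v) \<noteq> z"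
      using survivor_has_past[OF sub ca x N(2)] by blast
    have "\<exists>v\<in>reach N t. (c ^^ t) (shift w x) v \<noteq> z" if "t \<le> n" for t
      using w that \<open>n \<le> m\<close> unfolding iterate_shift[OF sub ca x]
      unfolding shift_def by (simp add: add.commute)
    then have "shift w x \<in> K n"
      using shift_in_subshift[OF sub x] unfolding K_def by auto
    then show ?thesis by blast
  qed
  moreover have "decseq K"
    unfolding decseq_def K_def by (intro allI impI INF_superset_mono) auto
  ultimately have "(\<Inter>n. K n) \<noteq> {}"
    by (rule compact_space_imp_nest[OF compact_space_subshift[OF fin sub]])
  then obtain x where x: "\<And>n. x \<in> K n" by blast
  then have "x \<in> X" unfolding K_def by blast
  moreover have "\<exists>v. (c ^^ t) x v \<noteq> z" for t
    using x[of t] unfolding K_def by blast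
  ultimately show ?thesis by blast
qed

lemma weakly_nilpotent_fixes_zero:
  assumes "weakly_nilpotent z X c" "x \<in> X"
  shows "c (\<lambda>_. z) = (\<lambda>_. z)"
proof -
  obtain m where m: "\<And>n v. n \<ge> m \<Longrightarrow> (c ^^ n) x v = z"
    using assms unfolding weakly_nilpotent_def by blast
  have "(c ^^ m) x = (\<lambda>_. z)" "(c ^^ Suc m) x = (\<lambda>_. z)"
    using m[of m] m[of "Suc m"] by auto
  then show ?thesis by simp
qed

theorem proposition1:
  fixes S :: "'s set" and z :: 's
    and X :: "('s, 'd::finite) config set"
    and c :: "('s, 'd) config \<Rightarrow> ('s, 'd) config"
  assumes "finite S" and "z \<in> S"
    and "subshift S X"
    and "cellular_automaton S X c"
  shows "nilpotent z X c \<longleftrightarrow> weakly_nilpotent z X c"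
proof
  assume "nilpotent z X c"
  then show "weakly_nilpotent z X c"
    unfolding nilpotent_def weakly_nilpotent_def by blast
next
  assume weak: "weakly_nilpotent z X c"
  show "nilpotent z X c"
  proof (rule ccontr)
    assume not_nil: "\<not> nilpotent z X c"
    then have "X \<noteq> {}" unfolding nilpotent_def by blast
    then have "c (\<lambda>_. z) = (\<lambda>_. z)"
      using weakly_nilpotent_fixes_zero[OF weak] by blast
    from immortal_configuration[OF assms(1,3,4) this not_nil] weak
    show False unfolding weakly_nilpotent_def by blast
  qed
qed

end
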